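(* Let $q$ and $q+1$ both be prime powers. The commutative association scheme on $X=\mathbb{F}_{q+1}\times\mathbb{F}_q\times\mathbb{F}_q$ with adjacency matrices $A_0=I_{(q+1)q^2}$, $A_1=I_{q+1}\otimes I_q\otimes(J_q-I_q)$, $A_2=I_{q+1}\otimes(J_q-I_q)\otimes J_q$, $A_3=(J_{q+1}-I_{q+1})\otimes I_{q^2}$, $A_4=(J_{q+1}-I_{q+1})\otimes I_q\otimes(J_q-I_q)$, $A_{5,\beta}=N_\beta-A_3$ ($\beta\in\mathbb{F}_{q+1}^*$), with $N_\beta$ as in the context, is self-dual.
   Context: $I_n,J_n$ are the identity and all-ones matrices of order $n$, $\mathbb{F}_r^*=\mathbb{F}_r\setminus\{0\}$, $\otimes$ is the Kronecker product. Let $x$ be a new symbol and fix a bijection $\varphi:\mathbb{F}_{q+1}\to\mathbb{F}_q\cup\{x\}$ with $\varphi(0)=x$. Matrices of order $(q+1)q^2$ have rows and columns indexed by $X$ in lexicographic order (compatible with Kronecker products). For $\beta\in\mathbb{F}_{q+1}^*$, $N_\beta$ is the $(0,1)$-matrix whose $((b,a_1,a_2),(b',a_1',a_2'))$-entry is $1$ if $c=\varphi(\beta(b'-b))$ lies in $\mathbb{F}_q$ and $a_2'-a_2=c(a_1'-a_1)$, and $0$ otherwise. These matrices form a commutative association scheme. For a commutative association scheme with adjacency matrices $A_0,\dots,A_n$, the Bose–Mesner algebra (their linear span) has a basis of primitive idempotents $E_0=\frac{1}{|X|}J_{|X|},E_1,\dots,E_n$; the first and second eigenmatrices $P=(p_{ij})$,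 $Q=(q_{ij})$ are defined by $A_j=\sum_ip_{ij}E_i$ and $E_j=\frac{1}{|X|}\sum_iq_{ij}A_i$. The scheme is self-dual if $P=\overline{Q}$ (complex conjugate) for a suitable ordering of the adjacency matrices and of the primitive idempotents. *)

theory Defs
  imports "HOL-Analysis.Analysis" "HOL-Number_Theory.Prime_Powers"
begin

text \<open>
  Matrices with rows and columns indexed by a finite type \<open>'n\<close> have type
  \<open>complex ^ 'n ^ 'n\<close>.  The identity matrix is \<open>mat 1\<close> and the matrix product is \<open>**\<close>.
\<close>

definition all_ones :: "complex ^ 'n ^ 'n" where
  "all_ones = (\<chi> i j. 1)"

definition cscale :: "complex \<Rightarrow> complex ^ 'n ^ 'n \<Rightarrow> complex ^ 'n ^ 'n"  (infixr \<open>*\<^sub>C\<close> 75) where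
  "c *\<^sub>C M = (\<chi> i j. c * M $ i $ j)"

text \<open>
  The Kronecker product is indexed by pairs, so no enumeration of the index types is needed;
  it associates to the right, like the product type.
\<close>

definition kron :: "complex ^ 'm ^ 'm \<Rightarrow> complex ^ 'n ^ 'n \<Rightarrow> complex ^ ('m \<times> 'n) ^ ('m \<times> 'n)"
    (infixr \<open>\<otimes>\<^sub>K\<close> 70) where
  "M \<otimes>\<^sub>K N = (\<chi> r s. M $ fst r $ fst s * N $ snd r $ snd s)"


section \<open>Commutative association schemes and self-duality\<close>

text \<open>
  A scheme is given by the set of its adjacency matrices.  The coefficients \<open>p C\<close> below are the
  intersection numbers.
\<close>

definition commutative_association_scheme :: "(complex ^ 'n::finite ^ 'n) set \<Rightarrow> bool" where
  "commutative_association_scheme \<A> \<longleftrightarrow>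
     finite \<A> \<and>
     mat 1 \<in> \<A> \<and>
     (\<forall>A\<in>\<A>. A \<noteq> 0 \<and> (\<forall>i j. A $ i $ j \<in> {0, 1})) \<and>
     (\<Sum>A\<in>\<A>. A) = all_ones \<and>
     (\<forall>A\<in>\<A>. transpose A \<in> \<A>) \<and>
     (\<forall>A\<in>\<A>. \<forall>B\<in>\<A>. \<exists>p :: complex ^ 'n ^ 'n \<Rightarrow> nat. A ** B = (\<Sum>C\<in>\<A>. of_nat (p C) *\<^sub>C C)) \<and>
     (\<forall>A\<in>\<A>. \<forall>B\<in>\<A>. A ** B = B ** A)"

definition bose_mesner_algebra :: "(complex ^ 'n ^ 'n) set \<Rightarrow> (complex ^ 'n ^ 'n) set" where
  "bose_mesner_algebra \<A> = {\<Sum>A\<in>\<A>. c A *\<^sub>C A | c. True}"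

text \<open>Primitive means: not a sum of two nonzero orthogonal idempotents of the algebra.\<close>

definition primitive_idempotents :: "(complex ^ 'n::finite ^ 'n) set \<Rightarrow> (complex ^ 'n ^ 'n) set" where
  "primitive_idempotents B =
     {E \<in> B. E \<noteq> 0 \<and> E ** E = E \<and>
        \<not> (\<exists>F\<in>B. \<exists>G\<in>B. F \<noteq> 0 \<and> G \<noteq> 0 \<and> F ** F = F \<and> G ** G = G \<and>
              F ** G = 0 \<and> G ** F = 0 \<and> E = F + G)}"

text \<open>
  For orderings \<open>A 0, \<dots>, A n\<close> of the adjacency matrices and \<open>E 0, \<dots>, E n\<close> of the primitive
  idempotents, the entries \<open>P i j\<close> and \<open>Q i j\<close> with \<open>i, j \<le> n\<close> are determined uniquely by the
  following predicates, as both families are bases of the Bose--Mesner algebra.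
\<close>

definition first_eigenmatrix ::
    "nat \<Rightarrow> (nat \<Rightarrow> complex ^ 'n ^ 'n) \<Rightarrow> (nat \<Rightarrow> complex ^ 'n ^ 'n) \<Rightarrow> (nat \<Rightarrow> nat \<Rightarrow> complex) \<Rightarrow> bool" where
  "first_eigenmatrix n A E P \<longleftrightarrow> (\<forall>j\<le>n. A j = (\<Sum>i\<le>n. P i j *\<^sub>C E i))"

definition second_eigenmatrix ::
    "nat \<Rightarrow> (nat \<Rightarrow> complex ^ 'n::finite ^ 'n) \<Rightarrow> (nat \<Rightarrow> complex ^ 'n ^ 'n) \<Rightarrow> (nat \<Rightarrow> nat \<Rightarrow> complex) \<Rightarrow> bool" where
  "second_eigenmatrix n A E Q \<longleftrightarrow>
     (\<forall>j\<le>n. E j = (1 / of_nat CARD('n)) *\<^sub>C (\<Sum>i\<le>n. Q i j *\<^sub>C A i))"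

text \<open>As usual, orderings start with \<open>A 0 = I\<close> and \<open>E 0 = J / |X|\<close>.\<close>

definition self_dual :: "(complex ^ 'n::finite ^ 'n) set \<Rightarrow> bool" where
  "self_dual \<A> \<longleftrightarrow>
     (\<exists>n A E P Q.
        bij_betw A {..n} \<A> \<and> A 0 = mat 1 \<and>
        bij_betw E {..n} (primitive_idempotents (bose_mesner_algebra \<A>)) \<and>
        E 0 = (1 / of_nat CARD('n)) *\<^sub>C all_ones \<and>
        first_eigenmatrix n A E P \<and> second_eigenmatrix n A E Q \<and>
        (\<forall>i\<le>n. \<forall>j\<le>n. P i j = cnj (Q i j)))"


section \<open>The scheme\<close>

text \<open>
  The field types \<open>'k\<close> and \<open>'f\<close> play the roles of $\mathbb{F}_{q+1}$ and $\mathbb{F}_q$.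
  The set $\mathbb{F}_q \cup \{x\}$ is \<open>'f option\<close>, with \<open>None\<close> for the new symbol $x$.
\<close>

definition N_matrix ::
    "('k::{field,finite} \<Rightarrow> 'f::{field,finite} option) \<Rightarrow> 'k \<Rightarrow> complex ^ ('k \<times> 'f \<times> 'f) ^ ('k \<times> 'f \<times> 'f)" where
  "N_matrix \<phi> \<beta> = (\<chi> r s.
     (case (r, s) of ((b, a1, a2), (b', a1', a2')) \<Rightarrow>
        (case \<phi> (\<beta> * (b' - b)) of
           None \<Rightarrow> 0
         | Some c \<Rightarrow> if a2' - a2 = c * (a1' - a1) then 1 else 0)))"

definition A0 :: "complex ^ ('k::{field,finite} \<times> 'f::{field,finite} \<times> 'f) ^ ('k \<times> 'f \<times> 'f)" where
  "A0 = mat 1"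

definition A1 :: "complex ^ ('k::{field,finite} \<times> 'f::{field,finite} \<times> 'f) ^ ('k \<times> 'f \<times> 'f)" where
  "A1 = mat 1 \<otimes>\<^sub>K mat 1 \<otimes>\<^sub>K (all_ones - mat 1)"

definition A2 :: "complex ^ ('k::{field,finite} \<times> 'f::{field,finite} \<times> 'f) ^ ('k \<times> 'f \<times> 'f)" where
  "A2 = mat 1 \<otimes>\<^sub>K (all_ones - mat 1) \<otimes>\<^sub>K all_ones"

definition A3 :: "complex ^ ('k::{field,finite} \<times> 'f::{field,finite} \<times> 'f) ^ ('k \<times> 'f \<times> 'f)" where
  "A3 = (all_ones - mat 1) \<otimes>\<^sub>K mat 1"

definition A4 :: "complex ^ ('k::{field,finite} \<times> 'f::{field,finite} \<times> 'f) ^ ('k \<times> 'f \<times> 'f)" where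
  "A4 = (all_ones - mat 1) \<otimes>\<^sub>K mat 1 \<otimes>\<^sub>K (all_ones - mat 1)"

definition A5 ::
    "('k::{field,finite} \<Rightarrow> 'f::{field,finite} option) \<Rightarrow> 'k \<Rightarrow> complex ^ ('k \<times> 'f \<times> 'f) ^ ('k \<times> 'f \<times> 'f)" where
  "A5 \<phi> \<beta> = N_matrix \<phi> \<beta> - A3"

definition adjacency_matrices ::
    "('k::{field,finite} \<Rightarrow> 'f::{field,finite} option) \<Rightarrow> (complex ^ ('k \<times> 'f \<times> 'f) ^ ('k \<times> 'f \<times> 'f)) set" where
  "adjacency_matrices \<phi> = {A0, A1, A2, A3, A4} \<union> {A5 \<phi> \<beta> | \<beta>. \<beta> \<noteq> 0}"

end

theory Submission
  imports Defs
begin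

text \<open>
  All entries of the adjacency matrices depend only on the difference of the two indices, so the
  scheme is given by a partition of the group $\mathbb{F}_{q+1} \times \mathbb{F}_q^2$ into the classes
  of the differences.  Let $\psi$, $\theta$ be nontrivial additive characters of the two fields and
  identify the group with its character group by
  $\langle (u, v), (b, a) \rangle = \psi(ub)\,\theta(v_2 a_1 - v_1 a_2)$.  For $b \neq 0$ the slice at $b$
  of the support of $N_\beta$ is the line of slope $\varphi(\beta b)$, and exactly one of these lines
  contains a given $v$ with $v_1 \neq 0$.  Hence the character sum of this support at such a $(u, v)$
  is $q\,\psi(u b)$ with $\varphi(\beta b) = v_2 / v_1$, so it depends only on $\beta$ and
  $\gamma = 1 / (u \varphi^{-1}(v_2 / v_1))$ and equals $q\,\psi(1 / (\beta\gamma))$.  This is symmetric in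
  $\beta$ and $\gamma$, which is why the dual partition, with classes indexed by $\gamma$, has the same
  table of character sums as the original one.
\<close>

section \<open>Additive characters of finite fields\<close>

definition nontrivial_character :: "('a::{field,finite} \<Rightarrow> complex) \<Rightarrow> bool" where
  "nontrivial_character \<psi> \<longleftrightarrow>
     (\<forall>x y. \<psi> (x + y) = \<psi> x * \<psi> y) \<and> (\<forall>x. norm (\<psi> x) = 1) \<and> (\<exists>x. \<psi> x \<noteq> 1)"

text \<open>For a maximal proper additive subgroup \<open>H\<close>, the quotient is cyclic of order
  \<open>p\<close>, generated by any \<open>x\<close> outside \<open>H\<close>. Mapping the
  coordinate along \<open>x\<close> to the \<open>p\<close>-th roots of unity gives a
  character.\<close>

lemma ex_nontrivial_character: "\<exists>\<psi> :: 'a::{field,finite} \<Rightarrow> complex. nontrivial_character \<psi>"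
proof -
  define p where "p = CHAR('a)"
  have p: "prime p"
    unfolding p_def by (rule prime_CHAR_semidom) (simp add: finite_imp_CHAR_pos)
  have p0: "(of_nat p :: 'a) = 0"
    unfolding p_def by simp
  define \<S> where "\<S> = {H :: 'a set. 0 \<in> H \<and> (\<forall>x\<in>H. \<forall>y\<in>H. x - y \<in> H) \<and> H \<noteq> UNIV}"
  have "{0} \<noteq> (UNIV :: 'a set)"
    using one_neq_zero by blast
  then have "{0} \<in> \<S>"
    by (simp add: \<S>_def)
  then obtain H where H: "H \<in> \<S>" and max: "\<And>H'. H' \<in> \<S> \<Longrightarrow> H \<subseteq> H' \<Longrightarrow> H = H'"
    using finite_has_maximal[of \<S>] by auto
  have H0: "0 \<in> H" and Hdiff: "\<And>x y. x \<in> H \<Longrightarrow> y \<in> H \<Longrightarrow> x - y \<in> H" and "H \<noteq> UNIV"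
    using H by (auto simp: \<S>_def)
  then obtain x where x: "x \<notin> H"
    by blast
  have Hneg: "- y \<in> H" if "y \<in> H" for y
    using Hdiff[OF H0 that] by simp
  have Hadd: "y + z \<in> H" if "y \<in> H" "z \<in> H" for y z
    using Hdiff[OF that(1) Hneg[OF that(2)]] by simp
  have Hnat: "of_nat k * y \<in> H" if "y \<in> H" for k y
    by (induction k) (use H0 Hadd that in \<open>auto simp: algebra_simps\<close>)
  have Hint: "of_int k * y \<in> H" if "y \<in> H" for k y
    by (cases k) (use Hnat[OF that] Hneg in \<open>auto simp: of_nat_Suc simp del: of_nat_Suc\<close>)
  have "\<exists>k. y - of_int k * x \<in> H" for y
  proof -
    \<comment> \<open>\<open>H'\<close> is the subgroup generated by \<open>H\<close> and
      \<open>x\<close>, so maximality of \<open>H\<close> makes it the whole field.\<close>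
    define H' where "H' = {y. \<exists>k. y - of_int k * x \<in> H}"
    have "H \<subseteq> H'"
      unfolding H'_def by (auto intro: exI[of _ 0])
    moreover have "x \<in> H'"
      unfolding H'_def using H0 by (auto intro: exI[of _ 1])
    moreover have "y - z \<in> H'" if yz: "y \<in> H'" "z \<in> H'" for y z
    proof -
      obtain k l where "y - of_int k * x \<in> H" "z - of_int l * x \<in> H"
        using yz unfolding H'_def by blast
      then have "(y - of_int k * x) - (z - of_int l * x) \<in> H"
        by (rule Hdiff)
      then have "(y - z) - of_int (k - l) * x \<in> H"
        by (simp add: algebra_simps)
      then show ?thesis
        unfolding H'_def by blast
    qed
    ultimately have "H' = UNIV"
      using max[of H'] H0 x unfolding \<S>_def by blast
    then show ?thesis
      unfolding H'_def by blast
  qed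
  then obtain k where k: "\<And>y. y - of_int (k y) * x \<in> H"
    by metis
  \<comment> \<open>If \<open>p\<close> did not divide \<open>m\<close>, Bezout would express
    \<open>x\<close> as a multiple of \<open>of_int m * x\<close>, because \<open>p\<close>
    annihilates \<open>x\<close>; then \<open>x\<close> would lie in \<open>H\<close>.\<close>
  have dvd: "int p dvd m" if m: "of_int m * x \<in> H" for m
  proof (rule ccontr)
    assume "\<not> int p dvd m"
    then have "coprime (int p) m"
      using p prime_imp_coprime[of "int p" m] by simp
    then obtain a b where ab: "a * int p + b * m = 1"
      using bezout_int[of "int p" m] by auto
    have "x = of_int (a * int p + b * m) * x"
      using ab by simp
    also have "\<dots> = of_int b * (of_int m * x)"
      using p0 by (simp add: algebra_simps)
    finally show False
      using Hint[OF m, of b] x by metis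
  qed
  define \<zeta> where "\<zeta> m = cis (2 * pi * of_int m / of_nat p)" for m :: int
  have \<zeta>_add: "\<zeta> (m + n) = \<zeta> m * \<zeta> n" for m n
    by (simp add: \<zeta>_def cis_mult add_divide_distrib distrib_left)
  have \<zeta>_1: "\<zeta> m = 1" if "int p dvd m" for m
  proof -
    obtain l where "m = int p * l"
      using \<open>int p dvd m\<close> by blast
    then have "2 * pi * of_int m / of_nat p = 2 * pi * of_int l"
      using prime_gt_0_nat[OF p] by simp
    then show ?thesis
      by (simp add: \<zeta>_def cis_multiple_2pi)
  qed
  \<comment> \<open>The coordinate \<open>k y\<close> was chosen arbitrarily, but two choices differ
    by a multiple of \<open>p\<close>, where \<open>\<zeta>\<close> is 1.\<close>
  have \<zeta>_cong: "\<zeta> m = \<zeta> n" if "of_int (m - n) * x \<in> H" for m n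
    using \<zeta>_add[of "m - n" n] \<zeta>_1[OF dvd[OF that]] by simp
  have "nontrivial_character (\<lambda>y. \<zeta> (k y))"
    unfolding nontrivial_character_def
  proof (intro conjI allI)
    fix y z
    have "(y - of_int (k y) * x) + (z - of_int (k z) * x) - ((y + z) - of_int (k (y + z)) * x) \<in> H"
      by (intro Hdiff Hadd k)
    then have "\<zeta> (k (y + z)) = \<zeta> (k y + k z)"
      by (intro \<zeta>_cong) (simp add: algebra_simps)
    then show "\<zeta> (k (y + z)) = \<zeta> (k y) * \<zeta> (k z)"
      by (simp add: \<zeta>_add)
  next
    show "norm (\<zeta> (k y)) = 1" for y
      by (simp add: \<zeta>_def)
  next
    have "\<zeta> (k x) = \<zeta> 1"
      by (rule \<zeta>_cong) (use Hneg[OF k[of x]] in \<open>simp add: algebra_simps\<close>)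
    moreover have "\<zeta> 1 \<noteq> 1"
    proof
      assume "\<zeta> 1 = 1"
      then have "cos (2 * pi / of_nat p) = 1"
        by (simp add: \<zeta>_def complex_eq_iff)
      then obtain n :: int where "2 * pi / of_nat p = of_int n * 2 * pi"
        using cos_one_2pi_int by blast
      then have "1 = of_int n * real p"
        using prime_gt_0_nat[OF p] by (simp add: field_simps)
      then have "1 = n * int p"
        by (metis of_int_1 of_int_eq_iff of_int_mult of_int_of_nat_eq)
      then show False
        using prime_gt_1_nat[OF p] by (metis dvd_triv_right int_dvd_int_iff nat_dvd_1_iff_1 of_nat_1 less_irrefl)
    qed
    ultimately show "\<exists>y. \<zeta> (k y) \<noteq> 1"
      by metis
  qed
  then show ?thesis
    by blast
qed

context
  fixes \<psi> :: "'a::{field,finite} \<Rightarrow> complex"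
  assumes \<psi>: "nontrivial_character \<psi>"
begin

lemma character_add: "\<psi> (x + y) = \<psi> x * \<psi> y"
  and norm_character: "norm (\<psi> x) = 1"
  using \<psi> by (auto simp: nontrivial_character_def)

lemma character_0: "\<psi> 0 = 1"
  using character_add[of 0 0] norm_character[of 0] by auto

text \<open>Translating by some \<open>y\<close> with \<open>\<psi> y \<noteq> 1\<close> multiplies
  the complete sum by \<open>\<psi> y\<close>, which forces it to vanish.\<close>

lemma sum_character: "(\<Sum>x\<in>UNIV. \<psi> (u * x)) = (if u = 0 then of_nat CARD('a) else 0)"
proof (cases "u = 0")
  case False
  obtain y where y: "\<psi> y \<noteq> 1"
    using \<psi> by (auto simp: nontrivial_character_def)
  have "(\<Sum>x\<in>UNIV. \<psi> (u * x)) = (\<Sum>x\<in>UNIV. \<psi> x)"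
    by (rule sum.reindex_bij_witness[of _ "\<lambda>x. x / u" "\<lambda>x. u * x"]) (use False in auto)
  moreover have "(\<Sum>x\<in>UNIV. \<psi> x) = (\<Sum>x\<in>UNIV. \<psi> (y + x))"
    by (rule sum.reindex_bij_witness[of _ "\<lambda>x. y + x" "\<lambda>x. x - y"]) auto
  then have "(\<Sum>x\<in>UNIV. \<psi> x) = \<psi> y * (\<Sum>x\<in>UNIV. \<psi> x)"
    unfolding character_add sum_distrib_left[symmetric] .
  ultimately show ?thesis
    using y False by simp
qed (simp add: character_0)

lemma sum_character_nonzero:
  "(\<Sum>x\<in>-{0}. \<psi> (u * x)) = (if u = 0 then of_nat CARD('a) else 0) - 1"
  using sum.remove[of UNIV 0 "\<lambda>x. \<psi> (u * x)"]
  by (simp add: sum_character character_0 Compl_eq_Diff_UNIV)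

end

text \<open>For the dual side: exchanging the arguments of the symplectic form changes its
  sign.\<close>

lemma nontrivial_character_minus:
  assumes "nontrivial_character \<psi>"
  shows "nontrivial_character (\<lambda>x. \<psi> (- x))"
proof -
  obtain y where "\<psi> y \<noteq> 1"
    using assms by (auto simp: nontrivial_character_def)
  then have "\<psi> (- (- y)) \<noteq> 1"
    by simp
  moreover have "\<psi> (- (x + y)) = \<psi> (- x) * \<psi> (- y)" for x y
    using character_add[OF assms, of "- x" "- y"] by (simp add: add.commute)
  ultimately show ?thesis
    using norm_character[OF assms] unfolding nontrivial_character_def by blast
qed


section \<open>Orthogonal idempotents\<close>

type_synonym 'n cmat = "((complex, 'n) vec, 'n) vec"

lemma cscale_nth [simp]: "(c *\<^sub>C M) $ i $ j = c * M $ i $ j"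
  by (simp add: cscale_def)

lemma cscale_0_left [simp]: "0 *\<^sub>C M = 0"
  and cscale_1 [simp]: "1 *\<^sub>C M = M"
  by (simp_all add: vec_eq_iff)

lemma cscale_mult_left: "(c *\<^sub>C M) ** N = c *\<^sub>C (M ** N)"
  and cscale_mult_right: "M ** (c *\<^sub>C N) = c *\<^sub>C (M ** N)"
  by (simp_all add: vec_eq_iff matrix_matrix_mult_def sum_distrib_left mult_ac)

lemma sum_matrix_mult_left: "(\<Sum>i\<in>I. f i) ** N = (\<Sum>i\<in>I. f i ** N)"
  for N :: "'n::finite cmat"
proof -
  have "(\<Sum>k\<in>UNIV. \<Sum>i\<in>I. f i $ r $ k * N $ k $ s) = (\<Sum>i\<in>I. \<Sum>k\<in>UNIV. f i $ r $ k * N $ k $ s)" for r s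
    by (rule sum.swap)
  then show ?thesis
    by (simp add: matrix_matrix_mult_def vec_eq_iff sum_distrib_right)
qed

lemma sum_matrix_mult_right: "N ** (\<Sum>i\<in>I. f i) = (\<Sum>i\<in>I. N ** f i)"
  for N :: "'n::finite cmat"
proof -
  have "(\<Sum>k\<in>UNIV. \<Sum>i\<in>I. N $ r $ k * f i $ k $ s) = (\<Sum>i\<in>I. \<Sum>k\<in>UNIV. N $ r $ k * f i $ k $ s)" for r s
    by (rule sum.swap)
  then show ?thesis
    by (simp add: matrix_matrix_mult_def vec_eq_iff sum_distrib_left)
qed

locale orthogonal_idempotents =
  fixes E :: "'i \<Rightarrow> 'n::finite cmat" and I :: "'i set"
  assumes fin: "finite I"
    and nonzero: "i \<in> I \<Longrightarrow> E i \<noteq> 0"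
    and orth: "i \<in> I \<Longrightarrow> j \<in> I \<Longrightarrow> E i ** E j = (if i = j then E i else 0)"
begin

text \<open>The span of the idempotents is a copy of the functions on \<open>I\<close> with
  pointwise product; \<open>comb c\<close> is the matrix with eigenvalues
  \<open>c i\<close>.\<close>

definition comb :: "('i \<Rightarrow> complex) \<Rightarrow> 'n cmat" where
  "comb c = (\<Sum>i\<in>I. c i *\<^sub>C E i)"

lemma comb_mult: "comb a ** comb b = comb (\<lambda>i. a i * b i)"
proof -
  have "comb a ** comb b = (\<Sum>i\<in>I. \<Sum>j\<in>I. a i *\<^sub>C b j *\<^sub>C (E i ** E j))"
    unfolding comb_def sum_matrix_mult_left cscale_mult_left
    unfolding sum_matrix_mult_right cscale_mult_right
    by (simp add: vec_eq_iff sum_distrib_left)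
  also have "\<dots> = (\<Sum>i\<in>I. \<Sum>j\<in>I. if i = j then (a i * b i) *\<^sub>C E i else 0)"
    by (intro sum.cong refl) (auto simp: orth vec_eq_iff)
  finally show ?thesis
    by (simp add: comb_def fin sum.delta)
qed

lemma comb_single: "i \<in> I \<Longrightarrow> comb (\<lambda>j. if j = i then c else 0) = c *\<^sub>C E i"
  by (simp add: comb_def if_distrib[of "\<lambda>x. x *\<^sub>C _"] fin cong: if_cong)

lemma comb_eq_iff: "comb a = comb b \<longleftrightarrow> (\<forall>i\<in>I. a i = b i)"
proof
  assume eq: "comb a = comb b"
  show "\<forall>i\<in>I. a i = b i"
  proof
    fix i assume i: "i \<in> I"
    \<comment> \<open>Multiplying by \<open>E i\<close> kills all other terms and so isolates one
      coefficient.\<close>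
    have "c i *\<^sub>C E i = comb c ** E i" for c
      using comb_mult[of c "\<lambda>j. if j = i then 1 else 0"] comb_single[OF i, of 1]
        comb_single[OF i, of "c i"]
      by (simp add: if_distrib[of "\<lambda>x. c _ * x"] cong: if_cong)
    then have "a i *\<^sub>C E i = b i *\<^sub>C E i"
      by (simp add: eq)
    moreover obtain r s where "E i $ r $ s \<noteq> 0"
      using nonzero[OF i] by (auto simp: vec_eq_iff)
    ultimately show "a i = b i"
      by (metis cscale_nth mult_right_cancel)
  qed
qed (simp add: comb_def)

lemma comb_0: "comb (\<lambda>_. 0) = 0"
  by (simp add: comb_def)

lemma comb_add: "comb a + comb b = comb (\<lambda>i. a i + b i)"
  by (simp add: comb_def sum.distrib[symmetric] vec_eq_iff distrib_right)

lemma inj_on_idempotents: "inj_on E I"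
  by (rule inj_onI) (metis nonzero orth)

lemma comb_idem_iff: "comb c ** comb c = comb c \<longleftrightarrow> (\<forall>i\<in>I. c i = 0 \<or> c i = 1)"
  by (auto simp: comb_mult comb_eq_iff)

text \<open>In coordinates the idempotents are the 0-1 vectors, and a nonzero one has no orthogonal
  splitting exactly when it has a single 1.\<close>

lemma primitive_idempotents_eq: "primitive_idempotents (range comb) = E ` I"
proof (intro equalityI subsetI)
  fix F assume "F \<in> primitive_idempotents (range comb)"
  then obtain c where c: "F = comb c" "F \<noteq> 0" "F ** F = F"
    and prim: "\<And>G H. \<lbrakk>G \<in> range comb; H \<in> range comb; G \<noteq> 0; H \<noteq> 0; G ** G = G; H ** H = H;
                 G ** H = 0; H ** G = 0\<rbrakk> \<Longrightarrow> F \<noteq> G + H"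
    unfolding primitive_idempotents_def by blast
  have c01: "\<And>i. i \<in> I \<Longrightarrow> c i = 0 \<or> c i = 1"
    using c comb_idem_iff by blast
  obtain i where i: "i \<in> I" "c i \<noteq> 0"
    using c(1,2) comb_0 comb_eq_iff[of c "\<lambda>_. 0"] by auto
  \<comment> \<open>\<open>d\<close> is one coordinate from the support of \<open>c\<close> and
    \<open>e\<close> is the rest; a nonzero rest would split \<open>F\<close>.\<close>
  define d e where "d = (\<lambda>j. if j = i then 1 else 0 :: complex)"
    and "e = (\<lambda>j. if j = i then 0 else c j)"
  have "comb e = 0"
  proof (rule ccontr)
    assume "comb e \<noteq> 0"
    moreover have "comb d \<noteq> 0"
      using i comb_0 comb_eq_iff[of d "\<lambda>_. 0"] by (auto simp: d_def)
    moreover have "comb d ** comb d = comb d" "comb e ** comb e = comb e"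
      using c01 by (auto simp: comb_idem_iff d_def e_def)
    moreover have "comb d ** comb e = 0" "comb e ** comb d = 0"
      unfolding comb_mult comb_0[symmetric] comb_eq_iff by (auto simp: d_def e_def)
    moreover have "F = comb d + comb e"
      unfolding c(1) comb_add comb_eq_iff using c01 i by (auto simp: d_def e_def)
    ultimately show False
      using prim by blast
  qed
  then have "\<forall>j\<in>I. e j = 0"
    using comb_0 comb_eq_iff[of e "\<lambda>_. 0"] by simp
  then have "comb c = comb d"
    using c01 i by (auto simp: comb_eq_iff d_def e_def)
  then show "F \<in> E ` I"
    using c(1) comb_single[OF i(1), of 1] i(1) by (simp add: d_def)
next
  fix F assume "F \<in> E ` I"
  then obtain i where i: "i \<in> I" and F: "F = E i"
    by blast
  define d where "d = (\<lambda>j. if j = i then 1 else 0 :: complex)"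
  have Fd: "F = comb d"
    using comb_single[OF i, of 1] by (simp add: F d_def)
  have "\<not> (\<exists>G\<in>range comb. \<exists>H\<in>range comb. G \<noteq> 0 \<and> H \<noteq> 0 \<and> G ** G = G \<and> H ** H = H \<and>
              G ** H = 0 \<and> H ** G = 0 \<and> F = G + H)"
  proof
    assume "\<exists>G\<in>range comb. \<exists>H\<in>range comb. G \<noteq> 0 \<and> H \<noteq> 0 \<and> G ** G = G \<and> H ** H = H \<and>
              G ** H = 0 \<and> H ** G = 0 \<and> F = G + H"
    then obtain a b where ab: "comb a \<noteq> 0" "comb b \<noteq> 0" "comb a ** comb b = 0"
      "comb a ** comb a = comb a" "comb b ** comb b = comb b" "comb d = comb a + comb b"
      unfolding Fd by blast
    have prod: "\<forall>j\<in>I. a j * b j = 0"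
      using ab(3) unfolding comb_mult comb_0[symmetric] comb_eq_iff .
    have sum: "\<forall>j\<in>I. d j = a j + b j"
      using ab(6) unfolding comb_add comb_eq_iff .
    obtain j k where "j \<in> I" "a j \<noteq> 0" "k \<in> I" "b k \<noteq> 0"
      using ab(1,2) comb_0 comb_eq_iff[of _ "\<lambda>_. 0"] by metis
    \<comment> \<open>Away from \<open>i\<close> the coefficients of the two parts have sum and
      product 0, so both vanish. Both parts thus live at \<open>i\<close> alone, where their product
      cannot be 0.\<close>
    moreover have "j' = i" if "j' \<in> I" "a j' \<noteq> 0 \<or> b j' \<noteq> 0" for j'
    proof (rule ccontr)
      assume "j' \<noteq> i"
      then have "a j' + b j' = 0" "a j' * b j' = 0"
        using sum prod that(1) by (auto simp: d_def)
      then show False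
        using that(2) by auto
    qed
    ultimately show False
      using prod by (metis mult_eq_0_iff)
  qed
  moreover have "F \<noteq> 0" "F ** F = F"
    using i nonzero orth by (auto simp: F)
  ultimately show "F \<in> primitive_idempotents (range comb)"
    unfolding primitive_idempotents_def using Fd by blast
qed

end


section \<open>Dual partitions of a finite abelian group\<close>

text \<open>
  The fibres of \<open>cl\<close> are the classes of a translation scheme and those of \<open>cl'\<close> the classes of
  its dual, where \<open>\<omega>\<close> identifies the group with its character group.
\<close>

locale dual_partitions =
  fixes \<omega> :: "'g::{ab_group_add,finite} \<Rightarrow> 'g \<Rightarrow> complex"
    and cl cl' :: "'g \<Rightarrow> 'i"
    and P :: "'i \<Rightarrow> 'i \<Rightarrow> complex"
    and z :: 'i
  assumes add_right: "\<omega> h (x + y) = \<omega> h x * \<omega> h y"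
    and add_left: "\<omega> (g + h) x = \<omega> g x * \<omega> h x"
    and norm_1: "norm (\<omega> h x) = 1"
    and sum_right: "(\<Sum>x\<in>UNIV. \<omega> h x) = (if h = 0 then of_nat CARD('g) else 0)"
    and sum_left: "(\<Sum>h\<in>UNIV. \<omega> h x) = (if x = 0 then of_nat CARD('g) else 0)"
    and range_cl': "range cl' = range cl"
    and cl_eq_z_iff: "cl x = z \<longleftrightarrow> x = 0"
    and cl'_eq_z_iff: "cl' x = z \<longleftrightarrow> x = 0"
    and cl_minus: "cl x = cl y \<Longrightarrow> cl (- x) = cl (- y)"
    and class_sum: "j \<in> range cl \<Longrightarrow> (\<Sum>x | cl x = j. \<omega> h x) = P (cl' h) j"
    and class_sum': "j \<in> range cl \<Longrightarrow> (\<Sum>h | cl' h = j. \<omega> h x) = P (cl x) j"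
begin

abbreviation I :: "'i set" where "I \<equiv> range cl"

definition adj :: "'i \<Rightarrow> 'g cmat" where
  "adj i = (\<chi> r s. if cl (s - r) = i then 1 else 0)"

text \<open>The rank-one projection onto the character \<open>\<omega> h\<close> as a vector. With
  \<open>r - s\<close> here against \<open>s - r\<close> in \<open>adj\<close>, the eigenvalue of
  \<open>adj j\<close> on it is the class sum itself, not its conjugate.\<close>

definition char_idem :: "'g \<Rightarrow> 'g cmat" where
  "char_idem h = (\<chi> r s. \<omega> h (r - s) / of_nat CARD('g))"

definition idem :: "'i \<Rightarrow> 'g cmat" where
  "idem i = (\<Sum>h | cl' h = i. char_idem h)"

lemma nonzero_\<omega>: "\<omega> h x \<noteq> 0"
  using norm_1[of h x] by auto

lemma zero_right: "\<omega> h 0 = 1"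
  using add_right[of h 0 0] nonzero_\<omega>[of h 0] by simp

lemma zero_left: "\<omega> 0 x = 1"
  using add_left[of 0 0 x] nonzero_\<omega>[of 0 x] by simp

lemma minus_right: "\<omega> h (- x) = cnj (\<omega> h x)"
proof -
  have "\<omega> h x * \<omega> h (- x) = \<omega> h x * cnj (\<omega> h x)"
    using add_right[of h x "- x"] norm_1[of h x] by (simp add: zero_right complex_norm_square[symmetric])
  then show ?thesis
    using nonzero_\<omega> by simp
qed

lemma minus_left: "\<omega> (- h) x = \<omega> h (- x)"
proof -
  have "\<omega> h x * \<omega> (- h) x = \<omega> h x * \<omega> h (- x)"
    using add_right[of h x "- x"] add_left[of h "- h" x] by (simp add: zero_right zero_left)
  then show ?thesis
    using nonzero_\<omega> by simp
qed

text \<open>Orthogonality of characters: the sum over the middle index is the complete sum of the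
  character of \<open>h - g\<close>.\<close>

lemma char_idem_mult: "char_idem g ** char_idem h = (if g = h then char_idem g else 0)"
proof -
  have "(char_idem g ** char_idem h) $ r $ s = (if g = h then char_idem g else 0) $ r $ s" for r s
  proof -
    have "\<omega> g (r - t) * \<omega> h (t - s) = \<omega> g r * \<omega> h (- s) * \<omega> (h - g) t" for t
      using add_right[of g r "- t"] add_right[of h t "- s"] add_left[of h "- g" t] minus_left[of g t]
      by simp
    then have "(char_idem g ** char_idem h) $ r $ s
        = \<omega> g r * \<omega> h (- s) * (\<Sum>t\<in>UNIV. \<omega> (h - g) t) / (of_nat CARD('g) * of_nat CARD('g))"
      by (simp add: matrix_matrix_mult_def char_idem_def sum_distrib_left sum_divide_distrib)
    then show ?thesis
      using add_right[of g r "- s"] by (auto simp: sum_right char_idem_def)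
  qed
  then show ?thesis
    by (simp add: vec_eq_iff)
qed

lemma idem_mult: "idem i ** idem j = (if i = j then idem i else 0)"
  by (auto simp: idem_def sum_matrix_mult_left sum_matrix_mult_right char_idem_mult sum.delta
      intro!: sum.cong sum.neutral)

lemma idem_nonzero:
  assumes "i \<in> I"
  shows "idem i \<noteq> 0"
proof -
  obtain h where "cl' h = i"
    using assms range_cl' by (metis imageE)
  then have "card {h. cl' h = i} \<noteq> 0"
    by auto
  then have "idem i $ 0 $ 0 \<noteq> 0"
    by (simp add: idem_def char_idem_def sum_component zero_right)
  then show ?thesis
    by auto
qed

sublocale orthogonal_idempotents idem I
  by unfold_locales (auto simp: idem_nonzero idem_mult)

lemma adj_nth: "adj i $ r $ s = (if cl (s - r) = i then 1 else 0)"
  by (simp add: adj_def)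

lemma sum_adj_nth: "(\<Sum>i\<in>I. c i * adj i $ r $ s) = c (cl (s - r))"
  by (simp add: adj_nth if_distrib[of "\<lambda>x. _ * x"] cong: if_cong)

text \<open>Fourier inversion for the indicator function of a class.\<close>

lemma adj_eq_comb:
  assumes "j \<in> I"
  shows "adj j = comb (\<lambda>i. P i j)"
proof -
  have "comb (\<lambda>i. P i j) $ r $ s = adj j $ r $ s" for r s
  proof -
    let ?N = "of_nat CARD('g) :: complex"
    have "comb (\<lambda>i. P i j) $ r $ s = (\<Sum>i\<in>range cl'. \<Sum>h | h \<in> UNIV \<and> cl' h = i. P (cl' h) j * (\<omega> h (r - s) / ?N))"
      by (simp add: comb_def sum_component idem_def char_idem_def sum_distrib_left range_cl')
    also have "\<dots> = (\<Sum>h\<in>UNIV. P (cl' h) j * (\<omega> h (r - s) / ?N))"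
      by (rule sum.image_gen[symmetric]) simp
    \<comment> \<open>Once the eigenvalue is written as a class sum, exchanging the sums lets
      orthogonality in \<open>h\<close> single out \<open>x = s - r\<close>.\<close>
    also have "\<dots> = (\<Sum>h\<in>UNIV. \<Sum>x | cl x = j. \<omega> h (x + (r - s)) / ?N)"
      by (simp add: class_sum[OF assms, symmetric] add_right sum_distrib_right sum_divide_distrib)
    also have "\<dots> = (\<Sum>x | cl x = j. \<Sum>h\<in>UNIV. \<omega> h (x + (r - s)) / ?N)"
      by (rule sum.swap)
    also have "\<dots> = (\<Sum>x | cl x = j. if x = s - r then 1 else 0)"
      by (intro sum.cong refl) (auto simp: sum_divide_distrib[symmetric] sum_left algebra_simps)
    also have "\<dots> = adj j $ r $ s"
      by (simp add: adj_nth)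
    finally show ?thesis .
  qed
  then show ?thesis
    by (simp add: vec_eq_iff)
qed

text \<open>An entry of \<open>idem j\<close> is a dual class sum at \<open>r - s\<close>. Passing
  to \<open>s - r\<close> conjugates it, so the conjugate of the same table \<open>P\<close>
  appears.\<close>

lemma idem_eq_sum_adj:
  assumes "j \<in> I"
  shows "idem j = (1 / of_nat CARD('g)) *\<^sub>C (\<Sum>i\<in>I. cnj (P i j) *\<^sub>C adj i)"
proof -
  have "idem j $ r $ s = cnj (P (cl (s - r)) j) / of_nat CARD('g)" for r s
    using minus_right[of _ "s - r"]
    by (simp add: idem_def char_idem_def sum_component class_sum'[OF assms, symmetric] sum_divide_distrib)
  then show ?thesis
    by (simp add: vec_eq_iff sum_adj_nth)
qed

section \<open>Change of basis between adjacency matrices and idempotents\<close>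

lemma inj_on_adj: "inj_on adj I"
proof (rule inj_onI)
  fix i j assume "i \<in> I" "adj i = adj j"
  then obtain x where "cl x = i" "adj i $ 0 $ x = adj j $ 0 $ x"
    by auto
  then show "i = j"
    by (auto simp: adj_nth split: if_splits)
qed

lemma comb_eq_sum_adj: "\<exists>d. comb c = (\<Sum>i\<in>I. d i *\<^sub>C adj i)"
proof
  have "comb c = (\<Sum>j\<in>I. c j *\<^sub>C (1 / of_nat CARD('g)) *\<^sub>C (\<Sum>i\<in>I. cnj (P i j) *\<^sub>C adj i))"
    by (simp add: comb_def idem_eq_sum_adj[symmetric])
  then show "comb c = (\<Sum>i\<in>I. (\<Sum>j\<in>I. c j / of_nat CARD('g) * cnj (P i j)) *\<^sub>C adj i)"
    by (simp add: vec_eq_iff sum_adj_nth)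
qed

lemma sum_adj_eq_comb: "\<exists>d. (\<Sum>i\<in>I. c i *\<^sub>C adj i) = comb d"
proof
  have "(\<Sum>j\<in>I. c j *\<^sub>C adj j) = (\<Sum>j\<in>I. \<Sum>i\<in>I. (c j * P i j) *\<^sub>C idem i)"
    by (intro sum.cong refl) (simp add: adj_eq_comb comb_def vec_eq_iff sum_component sum_distrib_left mult_ac)
  also have "\<dots> = (\<Sum>i\<in>I. \<Sum>j\<in>I. (c j * P i j) *\<^sub>C idem i)"
    by (rule sum.swap)
  finally show "(\<Sum>i\<in>I. c i *\<^sub>C adj i) = comb (\<lambda>i. \<Sum>j\<in>I. c j * P i j)"
    by (simp add: comb_def vec_eq_iff sum_component sum_distrib_right)
qed

lemma bose_mesner_algebra_eq: "bose_mesner_algebra (adj ` I) = range comb"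
proof -
  have *: "(\<Sum>A\<in>adj ` I. c A *\<^sub>C A) = (\<Sum>i\<in>I. c (adj i) *\<^sub>C adj i)" for c
    by (simp add: sum.reindex[OF inj_on_adj])
  show ?thesis
  proof (intro equalityI subsetI)
    fix M assume "M \<in> bose_mesner_algebra (adj ` I)"
    then obtain c where "M = (\<Sum>i\<in>I. c (adj i) *\<^sub>C adj i)"
      unfolding bose_mesner_algebra_def * by blast
    then show "M \<in> range comb"
      using sum_adj_eq_comb[of "\<lambda>i. c (adj i)"] by auto
  next
    fix M assume "M \<in> range comb"
    then obtain d where "M = (\<Sum>i\<in>I. d i *\<^sub>C adj i)"
      using comb_eq_sum_adj by blast
    also have "\<dots> = (\<Sum>i\<in>I. d (inv_into I adj (adj i)) *\<^sub>C adj i)"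
      by (intro sum.cong refl) (simp add: inv_into_f_f[OF inj_on_adj])
    also have "\<dots> = (\<Sum>A\<in>adj ` I. (d \<circ> inv_into I adj) A *\<^sub>C A)"
      unfolding * by simp
    finally show "M \<in> bose_mesner_algebra (adj ` I)"
      unfolding bose_mesner_algebra_def by blast
  qed
qed

section \<open>The axioms of a commutative association scheme\<close>

lemma transpose_adj: "transpose (adj (cl x)) = adj (cl (- x))"
proof -
  have "cl (r - s) = cl x \<longleftrightarrow> cl (s - r) = cl (- x)" for r s
    using cl_minus[of "r - s" x] cl_minus[of "s - r" "- x"] by auto
  then show ?thesis
    by (simp add: vec_eq_iff transpose_def adj_nth)
qed

text \<open>
  The product lies in the span of the \<open>adj i\<close>, with coefficients that are entries of a product
  of \<open>0\<close>-\<open>1\<close>-matrices.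
\<close>

lemma intersection_numbers:
  assumes "i \<in> I" "j \<in> I"
  shows "\<exists>p :: 'g cmat \<Rightarrow> nat. adj i ** adj j = (\<Sum>C\<in>adj ` I. of_nat (p C) *\<^sub>C C)"
proof -
  obtain d where d: "adj i ** adj j = (\<Sum>l\<in>I. d l *\<^sub>C adj l)"
    using comb_eq_sum_adj[of "\<lambda>l. P l i * P l j"] by (auto simp: adj_eq_comb assms comb_mult)
  have "\<exists>n. d l = of_nat n" if "l \<in> I" for l
  proof -
    obtain x where x: "cl x = l"
      using \<open>l \<in> I\<close> by blast
    \<comment> \<open>Only \<open>adj l\<close> is nonzero in row 0 and column \<open>x\<close>, so
      this entry of the product is the coefficient.\<close>
    have "d l = (\<Sum>t\<in>UNIV. adj i $ 0 $ t * adj j $ t $ x)"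
      using d sum_adj_nth[of d 0 x] by (simp add: x matrix_matrix_mult_def vec_eq_iff)
    also have "\<dots> = of_nat (\<Sum>t\<in>UNIV. (if cl t = i then 1 else 0) * (if cl (x - t) = j then 1 else 0))"
      unfolding of_nat_sum by (intro sum.cong refl) (simp add: adj_nth)
    finally show ?thesis
      by blast
  qed
  then obtain n where n: "\<And>l. l \<in> I \<Longrightarrow> d l = of_nat (n l)"
    by metis
  have "adj i ** adj j = (\<Sum>C\<in>adj ` I. of_nat (n (inv_into I adj C)) *\<^sub>C C)"
    unfolding d sum.reindex[OF inj_on_adj] by (intro sum.cong refl) (simp add: n inv_into_f_f[OF inj_on_adj])
  then show ?thesis
    by (rule exI[of _ "\<lambda>C. n (inv_into I adj C)"])
qed

lemma z_in_I: "z \<in> I"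
  using cl_eq_z_iff[of 0] by (metis rangeI)

lemma adj_z: "adj z = mat 1"
  by (auto simp: vec_eq_iff adj_nth mat_def cl_eq_z_iff)

text \<open>The dual class \<open>z\<close> consists of the trivial character alone.\<close>

lemma idem_z: "idem z = (1 / of_nat CARD('g)) *\<^sub>C all_ones"
  by (simp add: vec_eq_iff idem_def cl'_eq_z_iff char_idem_def zero_left all_ones_def)

lemma commutative_association_scheme_adj: "commutative_association_scheme (adj ` I)"
  unfolding commutative_association_scheme_def
proof (intro conjI ballI)
  show "mat 1 \<in> adj ` I"
    using z_in_I adj_z by (metis imageI)
  show "(\<Sum>A\<in>adj ` I. A) = all_ones"
    using sum_adj_nth[of "\<lambda>_. 1"] by (simp add: sum.reindex[OF inj_on_adj] vec_eq_iff all_ones_def)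
next
  fix A assume "A \<in> adj ` I"
  then obtain x where A: "A = adj (cl x)"
    by blast
  have "A $ 0 $ x = 1"
    by (simp add: A adj_nth)
  then show "A \<noteq> 0"
    by auto
  show "\<forall>i j. A $ i $ j \<in> {0, 1}"
    by (simp add: A adj_nth)
  show "transpose A \<in> adj ` I"
    by (simp add: A transpose_adj)
  fix B assume "B \<in> adj ` I"
  then obtain y where B: "B = adj (cl y)"
    by blast
  show "\<exists>p :: 'g cmat \<Rightarrow> nat. A ** B = (\<Sum>C\<in>adj ` I. of_nat (p C) *\<^sub>C C)"
    unfolding A B by (intro intersection_numbers) auto
  show "A ** B = B ** A"
    by (simp add: A B adj_eq_comb comb_mult mult.commute)
qed auto

text \<open>One enumeration of the classes orders both families, and the two expansions then have
  coefficients \<open>P\<close> and its conjugate.\<close>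

lemma self_dual_adj: "self_dual (adj ` I)"
proof -
  obtain f where f: "bij_betw f {0..<card I} I"
    using ex_bij_betw_nat_finite[of I] by auto
  then have "z \<in> f ` {0..<card I}"
    using z_in_I by (simp only: bij_betw_imp_surj_on)
  then obtain m where m: "m < card I" "f m = z"
    by auto
  \<comment> \<open>Indices run from 0 to \<open>n\<close>, hence the 1 subtracted; the
    transposition moves \<open>z\<close> to index 0.\<close>
  define n where "n = card I - 1"
  define e where "e = f \<circ> Transposition.transpose 0 m"
  have "card I = Suc n"
    using m(1) by (simp add: n_def)
  then have n: "{0..<card I} = {..n}" and "m \<le> n"
    using m(1) by (simp_all add: atLeast0LessThan lessThan_Suc_atMost)
  have "bij_betw (Transposition.transpose 0 m) {..n} {..n}"
    by (rule permutes_imp_bij[OF permutes_swap_id]) (simp_all add: \<open>m \<le> n\<close>)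
  then have e: "bij_betw e {..n} I"
    using f unfolding n e_def by (rule bij_betw_trans)
  have e_0: "e 0 = z"
    by (simp add: e_def m(2))
  have e_in: "e i \<in> I" if "i \<le> n" for i
    using bij_betwE[OF e] that by blast
  have reindex: "(\<Sum>i\<le>n. g (e i)) = (\<Sum>i\<in>I. g i)" for g :: "'i \<Rightarrow> 'g cmat"
    using e by (rule sum.reindex_bij_betw)
  show ?thesis
    unfolding self_dual_def
  proof (intro exI conjI)
    show "bij_betw (adj \<circ> e) {..n} (adj ` I)"
      using bij_betw_trans[OF e inj_on_imp_bij_betw[OF inj_on_adj]] .
    show "bij_betw (idem \<circ> e) {..n} (primitive_idempotents (bose_mesner_algebra (adj ` I)))"
      using bij_betw_trans[OF e inj_on_imp_bij_betw[OF inj_on_idempotents]]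
      by (simp add: bose_mesner_algebra_eq primitive_idempotents_eq)
    show "(adj \<circ> e) 0 = mat 1" "(idem \<circ> e) 0 = (1 / of_nat CARD('g)) *\<^sub>C all_ones"
      by (simp_all add: e_0 adj_z idem_z)
    show "first_eigenmatrix n (adj \<circ> e) (idem \<circ> e) (\<lambda>i j. P (e i) (e j))"
      using reindex[of "\<lambda>i. P i (e _) *\<^sub>C idem i"]
      by (simp add: first_eigenmatrix_def adj_eq_comb[OF e_in] comb_def)
    show "second_eigenmatrix n (adj \<circ> e) (idem \<circ> e) (\<lambda>i j. cnj (P (e i) (e j)))"
      using reindex[of "\<lambda>i. cnj (P i (e _)) *\<^sub>C adj i"]
      by (simp add: second_eigenmatrix_def idem_eq_sum_adj[OF e_in])
    show "\<forall>i\<le>n. \<forall>j\<le>n. P (e i) (e j) = cnj (cnj (P (e i) (e j)))"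
      by simp
  qed
qed

end


section \<open>The class functions and their character sums\<close>

datatype 'k cls = C0 | C1 | C2 | C3 | C4 | C5 'k

text \<open>
  With \<open>\<tau> c = \<phi>\<^sup>-\<^sup>1(c)\<close> the fibres of \<open>cls \<tau>\<close> are the classes of the scheme, and replacing \<open>\<tau>\<close> by
  \<open>1 / \<tau>\<close> gives the dual classes.
\<close>

definition cls :: "('f::field \<Rightarrow> 'k::field) \<Rightarrow> 'k \<times> 'f \<times> 'f \<Rightarrow> 'k cls" where
  "cls \<tau> = (\<lambda>(b, a1, a2).
     if b = 0 then (if a1 = 0 then (if a2 = 0 then C0 else C1) else C2)
     else (if a1 = 0 then (if a2 = 0 then C3 else C4) else C5 (\<tau> (a2 / a1) / b)))"

text \<open>The symplectic form on the plane makes every line its own orthogonal complement.\<close>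

definition bichar ::
    "('k::{field,finite} \<Rightarrow> complex) \<Rightarrow> ('f::{field,finite} \<Rightarrow> complex) \<Rightarrow>
     'k \<times> 'f \<times> 'f \<Rightarrow> 'k \<times> 'f \<times> 'f \<Rightarrow> complex" where
  "bichar \<psi> \<theta> = (\<lambda>(u, v1, v2) (b, a1, a2). \<psi> (u * b) * \<theta> (v2 * a1 - v1 * a2))"

text \<open>The eigenvalue of class \<open>j\<close> at a character \<open>(u, v1, v2)\<close> of
  dual class \<open>i\<close>. Here \<open>k\<close> is the sum of \<open>\<psi> (u * b)\<close>
  over nonzero \<open>b\<close>, and \<open>f1\<close> is the complete sum of
  \<open>\<theta> (- v1 * a)\<close>. If \<open>v1 = 0\<close>, \<open>f2\<close> is the sum of
  \<open>\<theta> (v2 * a)\<close> over nonzero \<open>a\<close>; otherwise it occurs only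
  multiplied by \<open>f1 = 0\<close>.\<close>

definition eigenmatrix :: "nat \<Rightarrow> ('k::{field,finite} \<Rightarrow> complex) \<Rightarrow> 'k cls \<Rightarrow> 'k cls \<Rightarrow> complex" where
  "eigenmatrix q \<psi> i j =
    (let k = (if i \<in> {C0, C1, C2} then of_nat CARD('k) else 0) - 1;
         f1 = (if i \<in> {C0, C1, C3, C4} then of_nat q else 0);
         f2 = (if i \<in> {C0, C3} then of_nat q else 0) - 1
     in case j of
          C0 \<Rightarrow> 1
        | C1 \<Rightarrow> f1 - 1
        | C2 \<Rightarrow> f2 * f1
        | C3 \<Rightarrow> k
        | C4 \<Rightarrow> k * (f1 - 1)
        | C5 \<beta> \<Rightarrow> (case i of
              C2 \<Rightarrow> of_nat q - k
            | C5 \<gamma> \<Rightarrow> of_nat q * \<psi> (1 / (\<gamma> * \<beta>)) - k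
            | _ \<Rightarrow> k * f2))"

lemma cls_Pair:
  "cls \<tau> (b, a1, a2) =
    (if b = 0 then (if a1 = 0 then (if a2 = 0 then C0 else C1) else C2)
     else (if a1 = 0 then (if a2 = 0 then C3 else C4) else C5 (\<tau> (a2 / a1) / b)))"
  by (simp add: cls_def)

text \<open>Negation keeps the slope \<open>a2 / a1\<close> and negates \<open>b\<close>, so only
  the parameter of \<open>C5\<close> changes.\<close>

lemma cls_minus: "cls \<tau> (- x) = map_cls uminus (cls \<tau> x)"
  by (cases x) (simp add: cls_Pair)

lemma cls_eq_C0_iff: "cls \<tau> x = C0 \<longleftrightarrow> x = 0"
  by (cases x) (simp add: cls_Pair zero_prod_def)

lemma range_cls:
  fixes \<tau> :: "'f::field \<Rightarrow> 'k::field"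
  assumes "bij_betw \<tau> UNIV (- {0})"
  shows "range (cls \<tau>) = {C0, C1, C2, C3, C4} \<union> C5 ` (- {0})"
proof (intro equalityI subsetI)
  fix i assume "i \<in> range (cls \<tau>)"
  moreover have "\<tau> c \<noteq> 0" for c
    using bij_betwE[OF assms] by simp
  ultimately show "i \<in> {C0, C1, C2, C3, C4} \<union> C5 ` (- {0})"
    by (auto simp: cls_Pair split: if_splits)
next
  fix i :: "'k cls" assume "i \<in> {C0, C1, C2, C3, C4} \<union> C5 ` (- {0})"
  moreover have "cls \<tau> (0, 0, 0) = C0" "cls \<tau> (0, 0, 1) = C1" "cls \<tau> (0, 1, 0) = C2"
    "cls \<tau> (1, 0, 0) = C3" "cls \<tau> (1, 0, 1) = C4"
    by (simp_all add: cls_Pair)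
  \<comment> \<open>The witness has slope 0, and its first coordinate solves
    \<open>\<tau> 0 / b = \<beta>\<close>.\<close>
  moreover have "cls \<tau> (\<tau> 0 / \<beta>, 1, 0) = C5 \<beta>" if "\<beta> \<noteq> 0" for \<beta>
    using bij_betwE[OF assms] that by (simp add: cls_Pair)
  ultimately show "i \<in> range (cls \<tau>)"
    by (auto simp: image_iff) metis+
qed

context
  fixes \<psi> :: "'k::{field,finite} \<Rightarrow> complex" and \<theta> :: "'f::{field,finite} \<Rightarrow> complex"
  assumes \<psi>: "nontrivial_character \<psi>" and \<theta>: "nontrivial_character \<theta>"
begin

lemma sum_bichar_Times:
  "(\<Sum>x\<in>B \<times> C \<times> D. bichar \<psi> \<theta> (u, v1, v2) x) =
     (\<Sum>b\<in>B. \<psi> (u * b)) * ((\<Sum>a\<in>C. \<theta> (v2 * a)) * (\<Sum>a\<in>D. \<theta> (- v1 * a)))"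
proof -
  have "\<theta> (v2 * a - v1 * a') = \<theta> (v2 * a) * \<theta> (- v1 * a')" for a a'
    using character_add[OF \<theta>, of "v2 * a" "- v1 * a'"] by simp
  then show ?thesis
    unfolding sum_product sum.cartesian_product by (simp add: bichar_def case_prod_unfold)
qed

lemmas character_sums = sum_bichar_Times
  sum_character[OF \<psi>] sum_character_nonzero[OF \<psi>] character_0[OF \<psi>]
  sum_character[OF \<theta>] sum_character_nonzero[OF \<theta>] character_0[OF \<theta>]
  sum_character[OF \<theta>, of "- v", simplified] sum_character_nonzero[OF \<theta>, of "- v", simplified]
  for v

lemma sum_bichar:
  "(\<Sum>x\<in>UNIV. bichar \<psi> \<theta> h x) = (if h = 0 then of_nat CARD('k \<times> 'f \<times> 'f) else 0)"
  by (cases h) (simp add: UNIV_Times_UNIV[symmetric] character_sums zero_prod_def del: UNIV_Times_UNIV)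

text \<open>The class is a union of lines without the origin: slope \<open>c\<close> occurs at
  \<open>b = \<tau> c / \<beta>\<close>, with points \<open>(a, c * a)\<close> for nonzero
  \<open>a\<close>. There the form equals \<open>(v2 - v1 * c) * a\<close>, so the sum over
  \<open>a\<close> is explicit.\<close>

lemma sum_bichar_C5:
  assumes \<tau>: "bij_betw \<tau> UNIV (- {0})" and "\<beta> \<noteq> 0"
  shows "(\<Sum>x | cls \<tau> x = C5 \<beta>. bichar \<psi> \<theta> (u, v1, v2) x) =
    (\<Sum>c\<in>UNIV. \<psi> (u / \<beta> * \<tau> c) * ((if v2 = v1 * c then of_nat CARD('f) else 0) - 1))"
proof -
  have \<tau>0: "\<tau> c \<noteq> 0" for c
    using bij_betwE[OF \<tau>] by simp
  have \<tau>_inj: "\<tau> c = \<tau> d \<longleftrightarrow> c = d" for c d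
    using bij_betw_imp_inj_on[OF \<tau>] by (simp add: inj_eq)
  have "(\<Sum>x | cls \<tau> x = C5 \<beta>. bichar \<psi> \<theta> (u, v1, v2) x)
      = (\<Sum>(c, a)\<in>UNIV \<times> (- {0}). \<psi> (u / \<beta> * \<tau> c) * \<theta> ((v2 - v1 * c) * a))"
    by (rule sum.reindex_bij_witness[of _ "\<lambda>(c, a). (\<tau> c / \<beta>, a, c * a)" "\<lambda>(b, a1, a2). (a2 / a1, a1)"])
       (use \<open>\<beta> \<noteq> 0\<close> \<tau>0 in \<open>auto simp: cls_Pair bichar_def field_simps split: if_splits\<close>)
  also have "\<dots> = (\<Sum>c\<in>UNIV. \<psi> (u / \<beta> * \<tau> c) * (\<Sum>a\<in>-{0}. \<theta> ((v2 - v1 * c) * a)))"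
    by (simp add: sum.cartesian_product[symmetric] sum_distrib_left)
  finally show ?thesis
    by (simp add: sum_character_nonzero[OF \<theta>])
qed

text \<open>The classes \<open>C0\<close> to \<open>C4\<close> are product sets, over which the sum
  factors; a class \<open>C5 \<beta>\<close> is summed slope by slope.\<close>

lemma sum_bichar_cls:
  assumes \<tau>: "bij_betw \<tau> UNIV (- {0})" and j: "j \<in> range (cls \<tau>)"
  shows "(\<Sum>x | cls \<tau> x = j. bichar \<psi> \<theta> h x) =
    eigenmatrix CARD('f) \<psi> (cls (\<lambda>c. 1 / \<tau> c) h) j"
proof -
  obtain u v1 v2 where h: "h = (u, v1, v2)"
    by (cases h)
  have product: ?thesis
    if "{x. cls \<tau> x = j} = B \<times> C \<times> D"
      "(\<Sum>b\<in>B. \<psi> (u * b)) * ((\<Sum>a\<in>C. \<theta> (v2 * a)) * (\<Sum>a\<in>D. \<theta> (- v1 * a))) =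
         eigenmatrix CARD('f) \<psi> (cls (\<lambda>c. 1 / \<tau> c) (u, v1, v2)) j" for B C D
    using that by (simp only: h sum_bichar_Times)
  note simps = character_sums eigenmatrix_def cls_Pair Let_def
  show ?thesis
  proof (cases j)
    case C0
    show ?thesis
      by (rule product[of "{0}" "{0}" "{0}"]) (auto simp: C0 simps split: if_splits)
  next
    case C1
    show ?thesis
      by (rule product[of "{0}" "{0}" "- {0}"]) (auto simp: C1 simps split: if_splits)
  next
    case C2
    show ?thesis
      by (rule product[of "{0}" "- {0}" UNIV]) (auto simp: C2 simps split: if_splits)
  next
    case C3
    show ?thesis
      by (rule product[of "- {0}" "{0}" "{0}"]) (auto simp: C3 simps split: if_splits)
  next
    case C4
    show ?thesis
      by (rule product[of "- {0}" "{0}" "- {0}"]) (auto simp: C4 simps split: if_splits)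
  next
    case (C5 \<beta>)
    then have \<beta>: "\<beta> \<noteq> 0"
      using j by (auto simp: range_cls[OF \<tau>])
    define k where "k = (if u = 0 then of_nat CARD('k) else 0) - (1 :: complex)"
    have sum_\<tau>: "(\<Sum>c\<in>UNIV. \<psi> (u / \<beta> * \<tau> c)) = k"
      using sum.reindex_bij_betw[OF \<tau>, of "\<lambda>b. \<psi> (u / \<beta> * b)"] sum_character_nonzero[OF \<psi>, of "u / \<beta>"] \<beta>
      by (simp add: k_def)
    have eq: "(\<Sum>x | cls \<tau> x = j. bichar \<psi> \<theta> h x) =
        (\<Sum>c\<in>UNIV. \<psi> (u / \<beta> * \<tau> c) * ((if v2 = v1 * c then of_nat CARD('f) else 0) - 1))"
      unfolding C5 h by (rule sum_bichar_C5[OF \<tau> \<beta>])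
    show ?thesis
    proof (cases "v1 = 0")
      case True
      \<comment> \<open>The condition on \<open>v2\<close> is now the same for every slope, so its
        factor comes out of the sum.\<close>
      have "(\<Sum>x | cls \<tau> x = j. bichar \<psi> \<theta> h x) = k * ((if v2 = 0 then of_nat CARD('f) else 0) - 1)"
        unfolding eq True by (simp only: mult_zero_left sum_distrib_right[symmetric] sum_\<tau>)
      then show ?thesis
        by (auto simp: C5 h True simps k_def)
    next
      case False
      \<comment> \<open>Only the slope \<open>v2 / v1\<close> meets the condition. If
        \<open>u \<noteq> 0\<close> and \<open>\<gamma>\<close> is the dual label of
        \<open>h\<close>, the argument of \<open>\<psi>\<close> there is
        \<open>1 / (\<gamma> * \<beta>)\<close>; if \<open>u = 0\<close>, the value is 1, as in row
        \<open>C2\<close>.\<close>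
      then have "v2 = v1 * c \<longleftrightarrow> c = v2 / v1" for c
        by (auto simp: field_simps)
      then have "(\<Sum>x | cls \<tau> x = j. bichar \<psi> \<theta> h x) = of_nat CARD('f) * \<psi> (u / \<beta> * \<tau> (v2 / v1)) - k"
        unfolding eq right_diff_distrib sum_subtractf mult_1_right sum_\<tau>
        by (simp add: if_distrib[of "\<lambda>x. _ * x"] cong: if_cong)
      then show ?thesis
        using False by (auto simp: C5 h simps k_def mult.commute)
    qed
  qed
qed

end

text \<open>The dual class sums come from the same computation with \<open>1 / \<tau>\<close> for
  \<open>\<tau>\<close> and \<open>\<theta>\<close> composed with negation. The table involves
  neither \<open>\<tau>\<close> nor \<open>\<theta>\<close>, so both sides share it.\<close>

lemma dual_partitions_cls:
  fixes \<psi> :: "'k::{field,finite} \<Rightarrow> complex" and \<theta> :: "'f::{field,finite} \<Rightarrow> complex"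
  assumes \<psi>: "nontrivial_character \<psi>" and \<theta>: "nontrivial_character \<theta>"
    and \<tau>: "bij_betw \<tau> UNIV (- {0})"
  shows "dual_partitions (bichar \<psi> \<theta>) (cls \<tau>) (cls (\<lambda>c. 1 / \<tau> c)) (eigenmatrix CARD('f) \<psi>) C0"
proof -
  have "bij_betw (\<lambda>b. 1 / b) (- {0}) (- {0 :: 'k})"
    by (rule bij_betw_byWitness[of _ "\<lambda>b. 1 / b"]) auto
  then have \<tau>': "bij_betw (\<lambda>c. 1 / \<tau> c) UNIV (- {0})"
    using bij_betw_trans[OF \<tau>] by (simp add: o_def)
  have \<theta>': "nontrivial_character (\<lambda>x. \<theta> (- x))"
    by (rule nontrivial_character_minus[OF \<theta>])
  have swap: "bichar \<psi> \<theta> h x = bichar \<psi> (\<lambda>x. \<theta> (- x)) x h" for h x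
    by (cases h, cases x) (simp add: bichar_def mult.commute)
  show ?thesis
  proof
    show "bichar \<psi> \<theta> h (x + y) = bichar \<psi> \<theta> h x * bichar \<psi> \<theta> h y" for h x y
      by (cases h, cases x, cases y)
         (simp add: bichar_def character_add[OF \<psi>, symmetric] character_add[OF \<theta>, symmetric] algebra_simps)
    show "bichar \<psi> \<theta> (g + h) x = bichar \<psi> \<theta> g x * bichar \<psi> \<theta> h x" for g h x
      by (cases g, cases h, cases x)
         (simp add: bichar_def character_add[OF \<psi>, symmetric] character_add[OF \<theta>, symmetric] algebra_simps)
    show "norm (bichar \<psi> \<theta> h x) = 1" for h x
      by (simp add: bichar_def norm_mult norm_character[OF \<psi>] norm_character[OF \<theta>] split: prod.split)
    show "(\<Sum>x\<in>UNIV. bichar \<psi> \<theta> h x) = (if h = 0 then of_nat CARD('k \<times> 'f \<times> 'f) else 0)" for h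
      by (rule sum_bichar[OF \<psi> \<theta>])
    show "(\<Sum>h\<in>UNIV. bichar \<psi> \<theta> h x) = (if x = 0 then of_nat CARD('k \<times> 'f \<times> 'f) else 0)" for x
      unfolding swap by (rule sum_bichar[OF \<psi> \<theta>'])
    show "range (cls (\<lambda>c. 1 / \<tau> c)) = range (cls \<tau>)"
      by (simp only: range_cls[OF \<tau>] range_cls[OF \<tau>'])
    show "cls \<tau> x = C0 \<longleftrightarrow> x = 0" "cls (\<lambda>c. 1 / \<tau> c) x = C0 \<longleftrightarrow> x = 0" for x
      by (rule cls_eq_C0_iff)+
    show "cls \<tau> (- x) = cls \<tau> (- y)" if "cls \<tau> x = cls \<tau> y" for x y
      using that by (simp add: cls_minus)
    fix j assume j: "j \<in> range (cls \<tau>)"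
    then show "(\<Sum>x | cls \<tau> x = j. bichar \<psi> \<theta> h x) = eigenmatrix CARD('f) \<psi> (cls (\<lambda>c. 1 / \<tau> c) h) j" for h
      by (rule sum_bichar_cls[OF \<psi> \<theta> \<tau>])
    have "j \<in> range (cls (\<lambda>c. 1 / \<tau> c))"
      using j by (simp only: range_cls[OF \<tau>] range_cls[OF \<tau>'])
    then show "(\<Sum>h | cls (\<lambda>c. 1 / \<tau> c) h = j. bichar \<psi> \<theta> h x) = eigenmatrix CARD('f) \<psi> (cls \<tau> x) j" for x
      unfolding swap using sum_bichar_cls[OF \<psi> \<theta>' \<tau>', of j x] by simp
  qed
qed

section \<open>The adjacency matrices as classes of index differences\<close>

theorem theorem4p5:
  fixes q :: nat
    and \<phi> :: "'k::{field,finite} \<Rightarrow> 'f::{field,finite} option"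
  assumes "primepow q" and "primepow (q + 1)"
    and "CARD('f) = q" and "CARD('k) = q + 1"
    and "bij \<phi>" and "\<phi> 0 = None"
  shows "commutative_association_scheme (adjacency_matrices \<phi>) \<and>
         self_dual (adjacency_matrices \<phi>)"
proof -
  \<comment> \<open>\<open>\<tau>\<close> recovers from a slope the value of
    \<open>\<beta> * b\<close> at which it occurs; as \<open>None\<close> sits at 0, its range is
    the nonzero elements.\<close>
  define \<tau> where "\<tau> c = inv \<phi> (Some c)" for c
  have \<phi>_\<tau>: "\<phi> b = Some c \<longleftrightarrow> \<tau> c = b" for b c
    using \<open>bij \<phi>\<close> unfolding \<tau>_def by (metis bij_inv_eq_iff)
  have \<phi>_None: "\<phi> b = None \<longleftrightarrow> b = 0" for b
    using \<open>bij \<phi>\<close> \<open>\<phi> 0 = None\<close> by (metis bij_pointE)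
  have \<tau>: "bij_betw \<tau> UNIV (- {0})"
  proof (rule bij_betw_byWitness[of _ "\<lambda>b. the (\<phi> b)"])
    have *: "\<phi> (\<tau> c) = Some c" for c
      using \<phi>_\<tau> by blast
    then show "\<forall>c\<in>UNIV. the (\<phi> (\<tau> c)) = c"
      by simp
    show "range \<tau> \<subseteq> - {0}"
      using * \<phi>_None by (metis ComplI image_subsetI option.distinct(1) singletonD)
    show "\<forall>b\<in>- {0}. \<tau> (the (\<phi> b)) = b"
      using \<phi>_\<tau> \<phi>_None by (metis ComplD insertI1 option.exhaust_sel)
  qed simp
  obtain \<psi> :: "'k \<Rightarrow> complex" and \<theta> :: "'f \<Rightarrow> complex"
    where "nontrivial_character \<psi>" "nontrivial_character \<theta>"
    using ex_nontrivial_character by metis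
  then interpret dual_partitions "bichar \<psi> \<theta>" "cls \<tau>" "cls (\<lambda>c. 1 / \<tau> c)" "eigenmatrix CARD('f) \<psi>" C0
    using \<tau> by (rule dual_partitions_cls)
  note simps = vec_eq_iff adj_nth kron_def all_ones_def mat_def cls_Pair
  have "adj C0 = A0" "adj C1 = A1" "adj C2 = A2" "adj C3 = A3" "adj C4 = A4"
    unfolding A0_def A1_def A2_def A3_def A4_def by (auto simp: simps)
  moreover have "adj (C5 \<beta>) = A5 \<phi> \<beta>" if "\<beta> \<noteq> 0" for \<beta>
  proof -
    \<comment> \<open>In a slice \<open>b \<noteq> 0\<close> the support of \<open>N_matrix\<close>
      is a line through the origin; subtracting \<open>A3\<close> removes the origin and leaves the
      points with \<open>a1 \<noteq> 0\<close>.\<close>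
    have "(if cls \<tau> (b, a1, a2) = C5 \<beta> then 1 else 0) =
        (case \<phi> (\<beta> * b) of None \<Rightarrow> 0 | Some c \<Rightarrow> if a2 = c * a1 then 1 else 0)
        - (if b \<noteq> 0 \<and> a1 = 0 \<and> a2 = 0 then 1 else 0 :: complex)" for b a1 a2
    proof (cases "\<phi> (\<beta> * b)")
      case None
      then show ?thesis
        using \<open>\<beta> \<noteq> 0\<close> \<phi>_None[of "\<beta> * b"] \<open>\<phi> 0 = None\<close> by (simp add: cls_Pair)
    next
      case (Some c)
      then have "b \<noteq> 0" and \<tau>_c: "\<tau> c = \<beta> * b"
        using \<open>\<phi> 0 = None\<close> by (auto simp: \<phi>_\<tau>[symmetric])
      have "\<tau> (a2 / a1) = \<beta> * b \<longleftrightarrow> a2 / a1 = c"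
        using bij_betw_imp_inj_on[OF \<tau>] unfolding \<tau>_c[symmetric] by (simp add: inj_eq)
      with Some \<open>b \<noteq> 0\<close> show ?thesis
        by (auto simp: cls_Pair divide_eq_eq)
    qed
    then show ?thesis
      unfolding vec_eq_iff adj_nth A5_def A3_def N_matrix_def
      by (auto simp: kron_def all_ones_def mat_def)
  qed
  ultimately have "adjacency_matrices \<phi> = adj ` I"
    unfolding adjacency_matrices_def range_cls[OF \<tau>] by (auto simp: image_iff)
  then show ?thesis
    using commutative_association_scheme_adj self_dual_adj by simp
qed

end
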